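(* Let $A\neq\{1\}$ be a bi-skew brace with gamma function $\gamma$, and let $n$ be a nonnegative integer. Then $A$ is right nilpotent of class $n+1$ if and only if the group $\gamma(A)=\{\gamma(a)\mid a\in A\}\subseteq \operatorname{Aut}(A,\cdot)$ is nilpotent of class $n$.
   Context: A skew brace (meaning skew left brace) is a set $A$ with two group structures $(A,\cdot)$ (the additive group) and $(A,\circ)$ (the multiplicative group) such that $a\circ(b\cdot c)=(a\circ b)\cdot a^{-1}\cdot(a\circ c)$ for all $a,b,c\in A$, where $a^{-1}$ is the inverse of $a$ in $(A,\cdot)$. The two groups have the same neutral element, denoted $1$. A bi-skew brace is a skew brace $(A,\cdot,\circ)$ such that $(A,\circ,\cdot)$ is also a skew brace. The gamma function of a skew brace $(A,\cdot,\circ)$ is the group homomorphism $\gamma\colon(A,\circ)\to\operatorname{Aut}(A,\cdot)$ given by $\gamma(a)(b)=a^{-1}\cdot(a\circ b)$. For $a,b\in A$ put $a*b=a^{-1}\cdot(a\circ b)\cdot b^{-1}$. For subsets $X,Y\subseteq A$, $X*Y$ is the subgroup of $(A,\cdot)$ generated by $\{x*y\mid x\in X,\ y\in Y\}$. Set $A^{(1)}=A$ and $A^{(m)}=A^{(m-1)}*A$ for $m\ge2$. The skew brace $A$ is right nilpotent if $A^{(m)}=\{1\}$ for some $m\ge1$; if $m$ is minimal with this property, $m-1$ is called the right nilpotency class of $A$. The trivial group is nilpotent of class $0$. *)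

theory Defs
  imports "HOL-Algebra.Algebra"
begin

section \<open>Skew braces\<close>

text \<open>
  A skew brace \<open>(A, \<cdot>, \<circ>)\<close> is a pair of group records \<open>G = (A, \<cdot>)\<close> and \<open>M = (A, \<circ>)\<close> with the
  same carrier. That the neutral elements agree is a consequence (\<open>one_eq\<close> below).
\<close>

locale skew_brace = G: group G + M: group M
  for G :: "('a, 'b) monoid_scheme" (structure)
    and M :: "('a, 'c) monoid_scheme" (structure) +
  assumes carrier_eq: "carrier M = carrier G"
    and brace: "\<lbrakk>a \<in> carrier G; b \<in> carrier G; c \<in> carrier G\<rbrakk> \<Longrightarrow>
      a \<otimes>\<^bsub>M\<^esub> (b \<otimes>\<^bsub>G\<^esub> c) = (a \<otimes>\<^bsub>M\<^esub> b) \<otimes>\<^bsub>G\<^esub> inv\<^bsub>G\<^esub> a \<otimes>\<^bsub>G\<^esub> (a \<otimes>\<^bsub>M\<^esub> c)"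

definition bi_skew_brace :: "('a, 'b) monoid_scheme \<Rightarrow> ('a, 'c) monoid_scheme \<Rightarrow> bool" where
  "bi_skew_brace G M \<longleftrightarrow> skew_brace G M \<and> skew_brace M G"

definition gamma ::
    "('a, 'b) monoid_scheme \<Rightarrow> ('a, 'c) monoid_scheme \<Rightarrow> 'a \<Rightarrow> 'a \<Rightarrow> 'a" where
  "gamma G M a = (\<lambda>b \<in> carrier G. inv\<^bsub>G\<^esub> a \<otimes>\<^bsub>G\<^esub> (a \<otimes>\<^bsub>M\<^esub> b))"

definition gamma_group ::
    "('a, 'b) monoid_scheme \<Rightarrow> ('a, 'c) monoid_scheme \<Rightarrow> ('a \<Rightarrow> 'a) monoid" where
  "gamma_group G M = (AutoGroup G)\<lparr>carrier := gamma G M ` carrier G\<rparr>"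

subsection \<open>Right nilpotency\<close>

definition star ::
    "('a, 'b) monoid_scheme \<Rightarrow> ('a, 'c) monoid_scheme \<Rightarrow> 'a \<Rightarrow> 'a \<Rightarrow> 'a" where
  "star G M a b = inv\<^bsub>G\<^esub> a \<otimes>\<^bsub>G\<^esub> (a \<otimes>\<^bsub>M\<^esub> b) \<otimes>\<^bsub>G\<^esub> inv\<^bsub>G\<^esub> b"

definition star_set ::
    "('a, 'b) monoid_scheme \<Rightarrow> ('a, 'c) monoid_scheme \<Rightarrow> 'a set \<Rightarrow> 'a set \<Rightarrow> 'a set" where
  "star_set G M S T = generate G {star G M x y | x y. x \<in> S \<and> y \<in> T}"

text \<open>\<open>right_series G M m\<close> is \<open>A\<^sup>(\<^sup>m\<^sup>)\<close> for \<open>m \<ge> 1\<close>; the value at \<open>0\<close> is a dummy and is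
  excluded wherever the series is used.\<close>

fun right_series ::
    "('a, 'b) monoid_scheme \<Rightarrow> ('a, 'c) monoid_scheme \<Rightarrow> nat \<Rightarrow> 'a set" where
  "right_series G M 0 = carrier G"
| "right_series G M (Suc 0) = carrier G"
| "right_series G M (Suc (Suc m)) = star_set G M (right_series G M (Suc m)) (carrier G)"

definition right_nilpotent ::
    "('a, 'b) monoid_scheme \<Rightarrow> ('a, 'c) monoid_scheme \<Rightarrow> bool" where
  "right_nilpotent G M \<longleftrightarrow> (\<exists>m\<ge>1. right_series G M m = {\<one>\<^bsub>G\<^esub>})"

text \<open>Meaningful only if \<open>right_nilpotent G M\<close>.\<close>

definition right_nilpotency_class ::
    "('a, 'b) monoid_scheme \<Rightarrow> ('a, 'c) monoid_scheme \<Rightarrow> nat" where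
  "right_nilpotency_class G M = (LEAST m. m \<ge> 1 \<and> right_series G M m = {\<one>\<^bsub>G\<^esub>}) - 1"

section \<open>Nilpotent groups\<close>

definition commutator_subgroup ::
    "('a, 'b) monoid_scheme \<Rightarrow> 'a set \<Rightarrow> 'a set \<Rightarrow> 'a set" where
  "commutator_subgroup G H K =
    generate G {h \<otimes>\<^bsub>G\<^esub> k \<otimes>\<^bsub>G\<^esub> inv\<^bsub>G\<^esub> h \<otimes>\<^bsub>G\<^esub> inv\<^bsub>G\<^esub> k | h k. h \<in> H \<and> k \<in> K}"

text \<open>Indexed from \<open>0\<close>: in the usual notation, \<open>lower_central G k\<close> is the term \<open>\<Gamma>\<^sub>k\<^sub>+\<^sub>1(G)\<close> of
  the lower central series, so the class is the least \<open>k\<close> at which the series is trivial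
  (\<open>0\<close> for the trivial group).\<close>

primrec lower_central :: "('a, 'b) monoid_scheme \<Rightarrow> nat \<Rightarrow> 'a set" where
  "lower_central G 0 = carrier G"
| "lower_central G (Suc k) = commutator_subgroup G (lower_central G k) (carrier G)"

definition nilpotent :: "('a, 'b) monoid_scheme \<Rightarrow> bool" where
  "nilpotent G \<longleftrightarrow> group G \<and> (\<exists>k. lower_central G k = {\<one>\<^bsub>G\<^esub>})"

text \<open>Meaningful only if \<open>nilpotent G\<close>.\<close>

definition nilpotency_class :: "('a, 'b) monoid_scheme \<Rightarrow> nat" where
  "nilpotency_class G = (LEAST k. lower_central G k = {\<one>\<^bsub>G\<^esub>})"

section \<open>Basic facts\<close>

context skew_brace
begin

lemma mult_closed [simp]: "\<lbrakk>a \<in> carrier G; b \<in> carrier G\<rbrakk> \<Longrightarrow> a \<otimes>\<^bsub>M\<^esub> b \<in> carrier G"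
  using M.m_closed carrier_eq by simp

lemma one_eq: "\<one>\<^bsub>M\<^esub> = \<one>\<^bsub>G\<^esub>"
proof -
  have M1: "\<one>\<^bsub>M\<^esub> \<in> carrier G"
    using M.one_closed carrier_eq by simp
  have "\<one>\<^bsub>M\<^esub> \<otimes>\<^bsub>M\<^esub> (\<one>\<^bsub>G\<^esub> \<otimes>\<^bsub>G\<^esub> \<one>\<^bsub>G\<^esub>) =
      (\<one>\<^bsub>M\<^esub> \<otimes>\<^bsub>M\<^esub> \<one>\<^bsub>G\<^esub>) \<otimes>\<^bsub>G\<^esub> inv\<^bsub>G\<^esub> \<one>\<^bsub>M\<^esub> \<otimes>\<^bsub>G\<^esub> (\<one>\<^bsub>M\<^esub> \<otimes>\<^bsub>M\<^esub> \<one>\<^bsub>G\<^esub>)"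
    using brace M1 by blast
  then have "inv\<^bsub>G\<^esub> \<one>\<^bsub>M\<^esub> = \<one>\<^bsub>G\<^esub>"
    using M1 carrier_eq by simp
  then show ?thesis
    using M1 G.inv_eq_1_iff by simp
qed

lemma gamma_add:
  assumes "a \<in> carrier G" "b \<in> carrier G" "c \<in> carrier G"
  shows "gamma G M a (b \<otimes>\<^bsub>G\<^esub> c) = gamma G M a b \<otimes>\<^bsub>G\<^esub> gamma G M a c"
  using assms by (simp add: gamma_def brace G.m_assoc)

lemma mult_eq_gamma:
  assumes "a \<in> carrier G" "b \<in> carrier G"
  shows "a \<otimes>\<^bsub>M\<^esub> b = a \<otimes>\<^bsub>G\<^esub> gamma G M a b"
  using assms by (simp add: gamma_def G.m_assoc[symmetric])

lemma gamma_in_carrier [simp]: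
  "\<lbrakk>a \<in> carrier G; b \<in> carrier G\<rbrakk> \<Longrightarrow> gamma G M a b \<in> carrier G"
  by (simp add: gamma_def)

lemma gamma_in_extensional: "gamma G M a \<in> extensional (carrier G)"
  by (simp add: gamma_def)

lemma gamma_mult:
  assumes "a \<in> carrier G" "b \<in> carrier G" "c \<in> carrier G"
  shows "gamma G M (a \<otimes>\<^bsub>M\<^esub> b) c = gamma G M a (gamma G M b c)"
proof -
  have "(a \<otimes>\<^bsub>M\<^esub> b) \<otimes>\<^bsub>G\<^esub> gamma G M (a \<otimes>\<^bsub>M\<^esub> b) c = a \<otimes>\<^bsub>M\<^esub> (b \<otimes>\<^bsub>M\<^esub> c)"
    using assms carrier_eq M.m_assoc by (simp flip: mult_eq_gamma)
  also have "\<dots> = a \<otimes>\<^bsub>G\<^esub> gamma G M a (b \<otimes>\<^bsub>G\<^esub> gamma G M b c)"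
    using assms by (simp add: mult_eq_gamma)
  also have "\<dots> = (a \<otimes>\<^bsub>M\<^esub> b) \<otimes>\<^bsub>G\<^esub> gamma G M a (gamma G M b c)"
    using assms by (simp add: gamma_add mult_eq_gamma G.m_assoc)
  finally show ?thesis
    using assms by simp
qed

lemma gamma_one: "b \<in> carrier G \<Longrightarrow> gamma G M \<one>\<^bsub>G\<^esub> b = b"
  using M.l_one carrier_eq by (simp add: gamma_def flip: one_eq) (simp add: one_eq)

lemma gamma_auto:
  assumes a: "a \<in> carrier G"
  shows "gamma G M a \<in> auto G"
proof -
  let ?a' = "inv\<^bsub>M\<^esub> a"
  have a': "?a' \<in> carrier G"
    using a M.inv_closed carrier_eq by simp
  have "gamma G M a (gamma G M ?a' b) = b" "gamma G M ?a' (gamma G M a b) = b"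
    if "b \<in> carrier G" for b
    using that a a' carrier_eq one_eq by (simp_all add: gamma_one flip: gamma_mult)
  then have "bij_betw (gamma G M a) (carrier G) (carrier G)"
    using a a' by (intro bij_betwI[where g = "gamma G M ?a'"]) auto
  moreover have "gamma G M a \<in> hom G G"
    using a by (auto simp: hom_def gamma_add)
  ultimately show ?thesis
    by (simp add: auto_def Bij_def gamma_in_extensional)
qed

lemma gamma_hom: "group_hom M (AutoGroup G) (gamma G M)"
proof (intro group_hom.intro group_hom_axioms.intro)
  show "group M" ..
  show "group (AutoGroup G)"
    by (rule G.AutoGroup)
  show "gamma G M \<in> hom M (AutoGroup G)"
  proof (rule homI)
    fix a b
    assume ab: "a \<in> carrier M" "b \<in> carrier M"
    then have "gamma G M a \<in> Bij (carrier G)" "gamma G M b \<in> Bij (carrier G)"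
      using gamma_auto carrier_eq by (auto simp: auto_def)
    moreover have "gamma G M (a \<otimes>\<^bsub>M\<^esub> b) = compose (carrier G) (gamma G M a) (gamma G M b)"
      using ab carrier_eq
      by (intro extensionalityI[where A = "carrier G"])
        (auto simp: gamma_mult compose_eq gamma_in_extensional)
    ultimately show
      "gamma G M (a \<otimes>\<^bsub>M\<^esub> b) = gamma G M a \<otimes>\<^bsub>AutoGroup G\<^esub> gamma G M b"
      by (simp add: AutoGroup_def BijGroup_def)
  qed (simp add: gamma_auto carrier_eq AutoGroup_def)
qed

lemma group_gamma_group: "group (gamma_group G M)"
proof -
  interpret h: group_hom M "AutoGroup G" "gamma G M"
    by (rule gamma_hom)
  show ?thesis
    unfolding gamma_group_def
    using h.H.subgroup_imp_group[OF h.img_is_subgroup] carrier_eq by simp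
qed

end

end

theory Submission
  imports Defs
begin

text \<open>
  Let \<open>\<gamma>\<close> be the gamma function of \<open>(A, \<cdot>, \<circ>)\<close> and \<open>\<delta>\<close> that of the skew brace \<open>(A, \<circ>, \<cdot>)\<close>. Since
  \<open>a \<circ> \<gamma>(a)\<^sup>-\<^sup>1(b) = a \<cdot> b\<close>, the map \<open>\<delta>(a)\<close> is the inverse of \<open>\<gamma>(a)\<close>. Hence \<open>\<delta>\<close> has the same image as
  \<open>\<gamma>\<close>, and it is a homomorphism from the additive group \<open>(A, \<cdot>)\<close>, whereas \<open>\<gamma>\<close> is one from
  \<open>(A, \<circ>)\<close>. As \<open>\<delta>\<close> reverses \<open>\<circ>\<close> and preserves \<open>\<cdot>\<close>, it sends \<open>a * b = a\<^sup>-\<^sup>1 \<cdot> (a \<circ> b) \<cdot> b\<^sup>-\<^sup>1\<close> to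
  \<open>\<delta>(a)\<^sup>-\<^sup>1 \<delta>(b) \<delta>(a) \<delta>(b)\<^sup>-\<^sup>1\<close>, the commutator of \<open>\<delta>(a)\<^sup>-\<^sup>1\<close> and \<open>\<delta>(b)\<close>. By induction \<open>\<delta>\<close> therefore
  maps the right series of \<open>A\<close> onto the lower central series of \<open>\<gamma>(A)\<close> (lemma
  \<open>dual_gamma_image_right_series\<close>).

  The kernel of \<open>\<delta>\<close> consists of the \<open>a\<close> with \<open>a * b = 1\<close> for all \<open>b\<close>. So a term of the lower
  central series vanishes exactly when the corresponding term of the right series lies in this
  kernel, that is, when the next term of the right series vanishes (lemma
  \<open>right_series_trivial_iff\<close>). This accounts for the shift by one between the two classes.
\<close>

lemma (in skew_brace) star_eq_one_iff:
  assumes "a \<in> carrier G" "b \<in> carrier G"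
  shows "star G M a b = \<one>\<^bsub>G\<^esub> \<longleftrightarrow> a \<otimes>\<^bsub>M\<^esub> b = a \<otimes>\<^bsub>G\<^esub> b"
proof -
  have "star G M a b = \<one>\<^bsub>G\<^esub> \<longleftrightarrow> inv\<^bsub>G\<^esub> a \<otimes>\<^bsub>G\<^esub> (a \<otimes>\<^bsub>M\<^esub> b) = b"
    using assms G.inv_solve_right[of "\<one>\<^bsub>G\<^esub>" "inv\<^bsub>G\<^esub> a \<otimes>\<^bsub>G\<^esub> (a \<otimes>\<^bsub>M\<^esub> b)" b]
    by (auto simp: star_def)
  also have "\<dots> \<longleftrightarrow> a \<otimes>\<^bsub>M\<^esub> b = a \<otimes>\<^bsub>G\<^esub> b"
    using assms by (metis G.inv_solve_left mult_closed)
  finally show ?thesis .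
qed

lemma (in skew_brace) star_closed:
  "\<lbrakk>a \<in> carrier G; b \<in> carrier G\<rbrakk> \<Longrightarrow> star G M a b \<in> carrier G"
  by (simp add: star_def)

lemma (in skew_brace) right_series_subgroup: "subgroup (right_series G M m) G"
proof -
  have star_sub: "subgroup (star_set G M S (carrier G)) G" if "S \<subseteq> carrier G" for S
    unfolding star_set_def using that star_closed by (intro G.generate_is_subgroup) auto
  show ?thesis
  proof (induction m)
    case 0
    show ?case by (simp add: G.subgroup_self)
  next
    case (Suc m)
    then show ?case
      by (cases m) (auto simp: G.subgroup_self intro!: star_sub dest: subgroup.subset)
  qed
qed

text \<open>
  A bi-skew brace is symmetric in its two operations. Under the prefix \<open>dual\<close> every fact about
  the skew brace \<open>(A, \<cdot>, \<circ>)\<close> is also available for \<open>(A, \<circ>, \<cdot>)\<close>, in particular for \<open>\<delta>\<close>, which is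
  \<open>gamma M G\<close>.
\<close>

locale bi_brace = skew_brace G M + dual: skew_brace M G
  for G :: "('a, 'b) monoid_scheme" (structure)
    and M :: "('a, 'c) monoid_scheme" (structure)
begin

text \<open>
  Both \<open>a \<circ> \<gamma>(a)\<^sup>-\<^sup>1(b)\<close> and \<open>a \<circ> \<delta>(a)(b)\<close> equal \<open>a \<cdot> b\<close>, so \<open>\<delta>(a) = \<gamma>(a)\<^sup>-\<^sup>1\<close>, which is the value of
  \<open>\<gamma>\<close> at the inverse of \<open>a\<close> in \<open>(A, \<circ>)\<close>.
\<close>

lemma dual_gamma_eq:
  assumes a: "a \<in> carrier G"
  shows "gamma M G a = gamma G M (inv\<^bsub>M\<^esub> a)"
proof (rule extensionalityI[where A = "carrier G"])
  fix b
  assume b: "b \<in> carrier G"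
  have a': "inv\<^bsub>M\<^esub> a \<in> carrier G"
    using a M.inv_closed carrier_eq by simp
  have c: "gamma M G a b \<in> carrier G"
    using a b dual.gamma_in_carrier carrier_eq by simp
  have "a \<otimes>\<^bsub>M\<^esub> gamma M G a b = a \<otimes>\<^bsub>G\<^esub> b"
    using a b dual.mult_eq_gamma carrier_eq by simp
  then have "gamma G M a (gamma M G a b) = b"
    using a b c mult_eq_gamma by simp
  then have "gamma G M (inv\<^bsub>M\<^esub> a) b = gamma G M (inv\<^bsub>M\<^esub> a \<otimes>\<^bsub>M\<^esub> a) (gamma M G a b)"
    using a a' c gamma_mult by simp
  also have "\<dots> = gamma M G a b"
    using a c carrier_eq one_eq gamma_one by simp
  finally show "gamma M G a b = gamma G M (inv\<^bsub>M\<^esub> a) b" ..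
qed (use gamma_in_extensional dual.gamma_in_extensional carrier_eq in auto)

text \<open>
  Inversion in \<open>(A, \<circ>)\<close> is a bijection, so \<open>\<gamma>\<close> and \<open>\<delta>\<close> have the same image. The multiplication of
  an automorphism group is composition on the carrier, whichever group structure the maps preserve,
  so even the records coincide.
\<close>

lemma gamma_group_dual: "gamma_group M G = gamma_group G M"
proof -
  have "(\<lambda>a. inv\<^bsub>M\<^esub> a) ` carrier M = carrier M"
    using M.inv_closed M.inv_inv by (metis bij_betw_byWitness bij_betw_imp_surj_on image_subset_iff)
  then have "gamma G M ` (\<lambda>a. inv\<^bsub>M\<^esub> a) ` carrier G = gamma G M ` carrier G"
    using carrier_eq by simp
  then have "gamma M G ` carrier G = gamma G M ` carrier G"
    using dual_gamma_eq by (simp add: image_image)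
  then show ?thesis
    by (simp add: gamma_group_def AutoGroup_def carrier_eq)
qed

lemma dual_gamma_hom: "group_hom G (gamma_group G M) (gamma M G)"
proof -
  interpret d: group_hom G "AutoGroup M" "gamma M G"
    by (rule dual.gamma_hom)
  have "group_hom G (gamma_group M G) (gamma M G)"
    using dual.group_gamma_group d.homh carrier_eq
    by (auto simp: group_hom_def group_hom_axioms_def gamma_group_def hom_def)
  then show ?thesis
    by (simp add: gamma_group_dual)
qed

sublocale delta: group_hom G "gamma_group G M" "gamma M G"
  by (rule dual_gamma_hom)

lemma dual_gamma_surj: "gamma M G ` carrier G = carrier (gamma_group G M)"
  using carrier_eq by (simp flip: gamma_group_dual) (simp add: gamma_group_def)

text \<open>
  \<open>\<gamma>\<close> is multiplicative on \<open>(A, \<circ>)\<close> and \<open>\<delta>\<close> is its pointwise inverse, so \<open>\<delta>\<close> reverses products there,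
  while it preserves those of \<open>(A, \<cdot>)\<close>. This clash is what makes the star operation a commutator.
\<close>

lemma dual_gamma_antimult:
  assumes "a \<in> carrier G" "b \<in> carrier G"
  shows "gamma M G (a \<otimes>\<^bsub>M\<^esub> b) = gamma M G b \<otimes>\<^bsub>gamma_group G M\<^esub> gamma M G a"
proof -
  interpret h: group_hom M "AutoGroup G" "gamma G M"
    by (rule gamma_hom)
  have "gamma M G (a \<otimes>\<^bsub>M\<^esub> b) = gamma G M (inv\<^bsub>M\<^esub> b \<otimes>\<^bsub>M\<^esub> inv\<^bsub>M\<^esub> a)"
    using assms carrier_eq by (simp add: dual_gamma_eq M.inv_mult_group)
  also have "\<dots> = gamma G M (inv\<^bsub>M\<^esub> b) \<otimes>\<^bsub>AutoGroup G\<^esub> gamma G M (inv\<^bsub>M\<^esub> a)"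
    using assms by (intro h.hom_mult M.inv_closed) (simp_all add: carrier_eq)
  also have "\<dots> = gamma M G b \<otimes>\<^bsub>gamma_group G M\<^esub> gamma M G a"
    using assms by (simp add: dual_gamma_eq gamma_group_def)
  finally show ?thesis .
qed

lemma dual_gamma_star:
  assumes "a \<in> carrier G" "b \<in> carrier G"
  shows "gamma M G (star G M a b) =
    gamma M G (inv\<^bsub>G\<^esub> a) \<otimes>\<^bsub>gamma_group G M\<^esub> gamma M G b
      \<otimes>\<^bsub>gamma_group G M\<^esub> inv\<^bsub>gamma_group G M\<^esub> gamma M G (inv\<^bsub>G\<^esub> a)
      \<otimes>\<^bsub>gamma_group G M\<^esub> inv\<^bsub>gamma_group G M\<^esub> gamma M G b"
  using assms by (simp add: star_def dual_gamma_antimult delta.H.m_assoc)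

text \<open>
  A homomorphism maps a generated subgroup to the subgroup generated by the images, so only
  generators have to be compared. The right entries of the commutators exhaust \<open>\<gamma>(A)\<close> because
  \<open>\<delta>\<close> is onto it.
\<close>

lemma dual_gamma_image_star_set:
  assumes S: "subgroup S G"
  shows "gamma M G ` star_set G M S (carrier G) =
    commutator_subgroup (gamma_group G M) (gamma M G ` S) (carrier (gamma_group G M))"
proof -
  let ?H = "gamma_group G M" and ?d = "gamma M G"
  let ?X = "{star G M x y | x y. x \<in> S \<and> y \<in> carrier G}"
  have SG: "S \<subseteq> carrier G"
    using S by (rule subgroup.subset)
  have "?d ` ?X = {?d (star G M x y) | x y. x \<in> S \<and> y \<in> carrier G}"
    by blast
  \<comment> \<open>Inverting \<open>x\<close> permutes \<open>S\<close> and cancels the inverse on the left entry of the commutator.\<close>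
  also have "\<dots> = {?d (star G M (inv\<^bsub>G\<^esub> x) y) | x y. x \<in> S \<and> y \<in> carrier G}"
    using subgroup.m_inv_closed[OF S] SG by (metis (no_types, lifting) G.inv_inv subset_eq)
  also have "\<dots> = {h \<otimes>\<^bsub>?H\<^esub> k \<otimes>\<^bsub>?H\<^esub> inv\<^bsub>?H\<^esub> h \<otimes>\<^bsub>?H\<^esub> inv\<^bsub>?H\<^esub> k | h k. h \<in> ?d ` S \<and> k \<in> ?d ` carrier G}"
    
  proof (intro Collect_cong iffI; clarify)
    fix x y
    assume "x \<in> S" "y \<in> carrier G"
    then show "\<exists>h k. ?d (star G M (inv\<^bsub>G\<^esub> x) y) =
        h \<otimes>\<^bsub>?H\<^esub> k \<otimes>\<^bsub>?H\<^esub> inv\<^bsub>?H\<^esub> h \<otimes>\<^bsub>?H\<^esub> inv\<^bsub>?H\<^esub> k \<and> h \<in> ?d ` S \<and> k \<in> ?d ` carrier G"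
      using SG dual_gamma_star[of "inv\<^bsub>G\<^esub> x" y]
      by (intro exI[of _ "?d x"] exI[of _ "?d y"]) (auto simp del: delta.hom_inv)
  next
    fix x y
    assume "x \<in> S" "y \<in> carrier G"
    then show "\<exists>x' y'. ?d x \<otimes>\<^bsub>?H\<^esub> ?d y \<otimes>\<^bsub>?H\<^esub> inv\<^bsub>?H\<^esub> ?d x \<otimes>\<^bsub>?H\<^esub> inv\<^bsub>?H\<^esub> ?d y =
        ?d (star G M (inv\<^bsub>G\<^esub> x') y') \<and> x' \<in> S \<and> y' \<in> carrier G"
      using SG dual_gamma_star[of "inv\<^bsub>G\<^esub> x" y]
      by (intro exI[of _ x] exI[of _ y]) (auto simp del: delta.hom_inv)
  qed
  finally have "?d ` ?X = \<dots>" .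
  moreover have "?X \<subseteq> carrier G"
    using SG star_closed by auto
  ultimately show ?thesis
    unfolding star_set_def commutator_subgroup_def dual_gamma_surj[symmetric]
    using delta.generate_img[of ?X] by simp
qed

lemma dual_gamma_image_right_series:
  "gamma M G ` right_series G M (Suc k) = lower_central (gamma_group G M) k"
proof (induction k)
  case 0
  then show ?case
    by (simp add: dual_gamma_surj)
next
  case (Suc k)
  then show ?case
    by (simp add: dual_gamma_image_star_set right_series_subgroup)
qed

text \<open>
  Since \<open>a \<circ> \<delta>(a)(b) = a \<cdot> b\<close>, the map \<open>\<delta>(a)\<close> fixes \<open>b\<close> if and only if \<open>a \<circ> b = a \<cdot> b\<close>, which is
  also the condition for \<open>a * b = 1\<close>.
\<close>

lemma dual_gamma_eq_one_iff:
  assumes a: "a \<in> carrier G"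
  shows "gamma M G a = \<one>\<^bsub>gamma_group G M\<^esub> \<longleftrightarrow> (\<forall>b\<in>carrier G. star G M a b = \<one>\<^bsub>G\<^esub>)"
proof -
  have "gamma M G a = \<one>\<^bsub>gamma_group G M\<^esub> \<longleftrightarrow> (\<forall>b\<in>carrier G. gamma M G a b = b)"
    using dual.gamma_in_extensional carrier_eq
    by (auto simp: gamma_group_def AutoGroup_def BijGroup_def intro!: extensionalityI[where A = "carrier G"])
  also have "\<dots> \<longleftrightarrow> (\<forall>b\<in>carrier G. star G M a b = \<one>\<^bsub>G\<^esub>)"
  proof (intro ball_cong refl)
    fix b
    assume b: "b \<in> carrier G"
    have "gamma M G a b = b \<longleftrightarrow> a \<otimes>\<^bsub>M\<^esub> gamma M G a b = a \<otimes>\<^bsub>M\<^esub> b"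
      using a b carrier_eq dual.gamma_in_carrier by simp
    also have "\<dots> \<longleftrightarrow> star G M a b = \<one>\<^bsub>G\<^esub>"
      using a b carrier_eq by (auto simp: star_eq_one_iff simp flip: dual.mult_eq_gamma)
    finally show "gamma M G a b = b \<longleftrightarrow> star G M a b = \<one>\<^bsub>G\<^esub>" .
  qed
  finally show ?thesis .
qed

text \<open>
  \<open>A\<^sup>(\<^sup>k\<^sup>+\<^sup>2\<^sup>)\<close> is trivial if and only if all its generators \<open>a * b\<close> with \<open>a\<close> in \<open>A\<^sup>(\<^sup>k\<^sup>+\<^sup>1\<^sup>)\<close> are, that is,
  when \<open>A\<^sup>(\<^sup>k\<^sup>+\<^sup>1\<^sup>)\<close> lies in the kernel of \<open>\<delta>\<close>; and \<open>\<delta>\<close> maps it onto the term of index \<open>k\<close> of the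
  lower central series.
\<close>

lemma right_series_trivial_iff:
  "right_series G M (Suc (Suc k)) = {\<one>\<^bsub>G\<^esub>} \<longleftrightarrow>
    lower_central (gamma_group G M) k = {\<one>\<^bsub>gamma_group G M\<^esub>}"
proof -
  let ?R = "right_series G M (Suc k)"
  let ?X = "{star G M x y | x y. x \<in> ?R \<and> y \<in> carrier G}"
  have sub: "?R \<subseteq> carrier G" and one: "\<one>\<^bsub>G\<^esub> \<in> ?R"
    using right_series_subgroup subgroup.subset subgroup.one_closed by metis+
  have "generate G ?X = {\<one>\<^bsub>G\<^esub>} \<longleftrightarrow> ?X \<subseteq> {\<one>\<^bsub>G\<^esub>}"
  proof
    assume "?X \<subseteq> {\<one>\<^bsub>G\<^esub>}"
    then have "generate G ?X \<subseteq> generate G {\<one>\<^bsub>G\<^esub>}"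
      by (rule G.mono_generate)
    then show "generate G ?X = {\<one>\<^bsub>G\<^esub>}"
      using generate.one by (fastforce simp: G.generate_one)
  next
    have "?X \<subseteq> generate G ?X"
      by (rule subsetI) (rule generate.incl)
    then show "?X \<subseteq> {\<one>\<^bsub>G\<^esub>}" if "generate G ?X = {\<one>\<^bsub>G\<^esub>}"
      unfolding that .
  qed
  also have "\<dots> \<longleftrightarrow> (\<forall>x\<in>?R. \<forall>y\<in>carrier G. star G M x y = \<one>\<^bsub>G\<^esub>)"
    by blast
  also have "\<dots> \<longleftrightarrow> (\<forall>x\<in>?R. gamma M G x = \<one>\<^bsub>gamma_group G M\<^esub>)"
    using sub by (intro ball_cong refl dual_gamma_eq_one_iff[symmetric]) blast
  also have "\<dots> \<longleftrightarrow> gamma M G ` ?R = {\<one>\<^bsub>gamma_group G M\<^esub>}"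
    using one by (auto simp: set_eq_iff image_iff)
  finally show ?thesis
    by (simp add: dual_gamma_image_right_series star_set_def)
qed

end

theorem theorem3p6:
  fixes G :: "('a, 'b) monoid_scheme" and M :: "('a, 'c) monoid_scheme" and n :: nat
  assumes "bi_skew_brace G M"
    and "carrier G \<noteq> {\<one>\<^bsub>G\<^esub>}"
  shows "right_nilpotent G M \<and> right_nilpotency_class G M = n + 1 \<longleftrightarrow>
    nilpotent (gamma_group G M) \<and> nilpotency_class (gamma_group G M) = n"
proof -
  interpret bi_brace G M
    using assms(1) by (simp add: bi_brace_def bi_skew_brace_def)
  let ?R = "\<lambda>m. m \<ge> 1 \<and> right_series G M m = {\<one>\<^bsub>G\<^esub>}"
  let ?L = "\<lambda>k. lower_central (gamma_group G M) k = {\<one>\<^bsub>gamma_group G M\<^esub>}"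
  \<comment> \<open>The first term of the right series is \<open>A\<close>, nontrivial by assumption, so the minimal index lies in
    the range \<open>m \<ge> 2\<close> where the two series correspond.\<close>
  have R0: "\<not> ?R 0" and R1: "\<not> ?R (Suc 0)" and R2: "?R (Suc (Suc k)) \<longleftrightarrow> ?L k" for k
    using assms(2) right_series_trivial_iff by (simp_all del: right_series.simps(3))
  have R_ex: "right_nilpotent G M \<longleftrightarrow> (\<exists>m. ?R m)"
    by (auto simp: right_nilpotent_def)
  have "(\<exists>m. ?R m) \<longleftrightarrow> (\<exists>k. ?L k)"
    using R0 R1 R2 by (metis not0_implies_Suc)
  then have nil: "right_nilpotent G M \<longleftrightarrow> nilpotent (gamma_group G M)"
    by (simp add: R_ex nilpotent_def group_gamma_group)
  moreover have "right_nilpotency_class G M = nilpotency_class (gamma_group G M) + 1"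
    if "right_nilpotent G M"
  proof -
    have "\<exists>k. ?L k"
      using that unfolding nil nilpotent_def by (rule conjunct2)
    then have L: "?L (LEAST k. ?L k)"
      by (rule LeastI_ex)
    have "(LEAST m. ?R m) = Suc (Suc (LEAST k. ?L k))"
    proof (rule Least_equality)
      show "?R (Suc (Suc (LEAST k. ?L k)))"
        unfolding R2 by (rule L)
    next
      fix m
      assume m: "?R m"
      have "m \<noteq> 0" "m \<noteq> Suc 0"
        using m R0 R1 by (intro notI; simp only:)+
      then obtain k where k: "m = Suc (Suc k)"
        by (metis not0_implies_Suc)
      have "?L k"
        using m unfolding k R2 .
      then have "(LEAST k. ?L k) \<le> k"
        by (rule Least_le)
      then show "Suc (Suc (LEAST k. ?L k)) \<le> m"
        unfolding k by simp
    qed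
    then show ?thesis
      by (simp add: right_nilpotency_class_def nilpotency_class_def)
  qed
  ultimately show ?thesis
    by auto
qed

end
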